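(* Let $\alpha:\mathbb{F}_2^n\to\mathbb{F}_2$ be a cubic form and let $A,B\subset\mathbb{F}_2^n$ with $|A|\leq|B|$. Suppose that every proper additive quadruple $(x,x',y,y')$ (i.e. $x,x'\in A$, $y,y'\in B$, $x\neq x'$, $y\neq y'$, $x+x'+y+y'=0$) satisfies $\alpha(x+x')=1$. Then $|A+B|\geq\Omega(|A|^{6/5})$, i.e. there is an absolute constant $C>0$ (independent of $n$, $\alpha$, $A$, $B$) with $|A+B|\geq C|A|^{6/5}$.
   Context: A cubic form on $\mathbb{F}_2^n$ is a function $\alpha(x)=\sum_{1\leq i\leq j\leq k\leq n}\alpha_{ijk}x_ix_jx_k$ with $\alpha_{ijk}\in\mathbb{F}_2$. $A+B=\{a+b: a\in A, b\in B\}$. *)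

theory Defs
  imports
    Complex_Main
    "HOL-Library.Z2"
    "HOL-Library.Function_Algebras"
    "HOL-Library.Set_Algebras"
begin

(* The dimension n varies inside the statement, so F_2^n is a carrier set: functions
   with coordinates 1..n, required to vanish at all other arguments so that equality of
   functions is equality of vectors. Addition of vectors and 0 are the pointwise ones of
   Function_Algebras, and A + B for sets of vectors is the sumset of Set_Algebras. *)
definition F2_vecs :: "nat \<Rightarrow> (nat \<Rightarrow> bit) set" where
  "F2_vecs n = {x. \<forall>i. i \<notin> {1..n} \<longrightarrow> x i = 0}"

(* The indices may coincide; as x i * x i = x i over bit, terms of degree 1 and 2 are
   included. Values of the function outside F2_vecs n are unconstrained. *)
definition cubic_form :: "nat \<Rightarrow> ((nat \<Rightarrow> bit) \<Rightarrow> bit) \<Rightarrow> bool" where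
  "cubic_form n \<alpha> \<longleftrightarrow> (\<exists>c :: nat \<Rightarrow> nat \<Rightarrow> nat \<Rightarrow> bit. \<forall>x \<in> F2_vecs n.
     \<alpha> x = (\<Sum>i = 1..n. \<Sum>j = i..n. \<Sum>k = j..n. c i j k * x i * x j * x k))"

definition proper_additive_quadruple ::
    "(nat \<Rightarrow> bit) set \<Rightarrow> (nat \<Rightarrow> bit) set \<Rightarrow>
     (nat \<Rightarrow> bit) \<Rightarrow> (nat \<Rightarrow> bit) \<Rightarrow> (nat \<Rightarrow> bit) \<Rightarrow> (nat \<Rightarrow> bit) \<Rightarrow> bool" where
  "proper_additive_quadruple A B x x' y y' \<longleftrightarrow>
     x \<in> A \<and> x' \<in> A \<and> y \<in> B \<and> y' \<in> B \<and> x \<noteq> x' \<and> y \<noteq> y' \<and> x + x' + y + y' = 0"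

end

theory Submission
  imports Defs
begin

text \<open>
  For \<open>s \<in> A + B\<close> let \<open>A\<^sub>s\<close> be the set of all \<open>x \<in> A\<close> with \<open>s + x \<in> B\<close>. Any two distinct elements of
  \<open>A\<^sub>s\<close> form a proper quadruple with their translates by \<open>s\<close>, so \<open>\<alpha> (x + y) = 1\<close> for distinct
  \<open>x, y \<in> A\<^sub>s\<close>: the matrix \<open>\<alpha> (x + y)\<close> is \<open>J - I\<close>. On the other hand
  \<open>\<alpha> (x + y) = \<alpha> x + \<alpha> y + L x y + L y x\<close> with \<open>L\<close> linear in its first argument, so this
  matrix has rank at most \<open>2 d + 2\<close>, where \<open>d\<close> is the dimension of the span of \<open>A\<^sub>s\<close>. Hence \<open>A\<^sub>s\<close>
  contains about \<open>|A\<^sub>s| / 2\<close> independent vectors, whose pairwise sums, translated by \<open>s\<close>, lie in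
  \<open>A + B\<close>, and \<open>|A + B|\<close> is at least of order \<open>|A\<^sub>s|\<^sup>2\<close>. Since the \<open>A\<^sub>s\<close> have average size
  \<open>|A| |B| / |A + B|\<close>, this gives \<open>|A + B|\<^sup>3 \<ge> c |A|\<^sup>2 |B|\<^sup>2\<close>, an exponent of \<open>4/3 > 6/5\<close>.
\<close>

section \<open>Linear algebra over the two-element field\<close>

definition bit_scale :: "bit \<Rightarrow> ('a \<Rightarrow> bit) \<Rightarrow> 'a \<Rightarrow> bit" where
  "bit_scale c f = (\<lambda>i. c * f i)"

lemma bit_scale_apply [simp]: "bit_scale c f i = c * f i"
  by (simp add: bit_scale_def)

text \<open>The domain stays polymorphic: the structure serves both for vectors
  (\<open>nat \<Rightarrow> bit\<close>) and for functions of vectors, where the rank argument takes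
  place.\<close>

interpretation bit_fun: vector_space bit_scale
  by unfold_locales (auto simp: fun_eq_iff algebra_simps)

lemma sum_fun_apply:
  fixes f :: "'b \<Rightarrow> 'a \<Rightarrow> 'c::comm_monoid_add"
  shows "(\<Sum>v\<in>S. f v) x = (\<Sum>v\<in>S. f v x)"
  by (induction S rule: infinite_finite_induct) auto

lemma bit_fun_add_self: "(x :: 'a \<Rightarrow> bit) + x = 0"
  by (simp add: fun_eq_iff)

text \<open>Two equal subset sums add up to a vanishing combination whose coefficients are the
  indicator of the symmetric difference, which independence forces to be empty.\<close>

lemma inj_on_subset_sums:
  fixes I :: "('a \<Rightarrow> bit) set"
  assumes "finite I" "bit_fun.independent I"
  shows "inj_on (\<lambda>T. \<Sum>T) (Pow I)"
proof (rule inj_onI)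
  fix T U assume T: "T \<in> Pow I" and U: "U \<in> Pow I" and eq: "\<Sum>T = \<Sum>U"
  define u where "u v = (of_bool (v \<in> T) + of_bool (v \<in> U) :: bit)" for v
  have *: "(\<Sum>v\<in>I. bit_scale (of_bool (v \<in> W)) v) = \<Sum>W" if "W \<subseteq> I" for W :: "('a \<Rightarrow> bit) set"
  proof -
    have "(\<Sum>v\<in>I. bit_scale (of_bool (v \<in> W)) v) = (\<Sum>v\<in>I. if v \<in> W then v else 0)"
      by (rule sum.cong) (auto simp: fun_eq_iff)
    also have "\<dots> = \<Sum>W"
      using that assms(1) by (simp add: sum.inter_restrict[symmetric] Int_absorb1)
    finally show ?thesis .
  qed
  have "(\<Sum>v\<in>I. bit_scale (u v) v)
      = (\<Sum>v\<in>I. bit_scale (of_bool (v \<in> T)) v) + (\<Sum>v\<in>I. bit_scale (of_bool (v \<in> U)) v)"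
    unfolding sum.distrib[symmetric] u_def
    by (rule sum.cong) (auto simp: fun_eq_iff algebra_simps)
  also have "\<dots> = 0"
    using T U eq * by (simp add: bit_fun_add_self)
  finally have "u v = 0" if "v \<in> I" for v
    using bit_fun.independentD[OF assms(2) assms(1) order_refl] that by blast
  then have "v \<in> T \<longleftrightarrow> v \<in> U" if "v \<in> I" for v
    using that unfolding u_def by (force split: if_splits)
  with T U show "T = U" by blast
qed

section \<open>Cubic forms\<close>

lemma cubic_form_add:
  assumes "cubic_form n \<alpha>"
  obtains L :: "(nat \<Rightarrow> bit) \<Rightarrow> (nat \<Rightarrow> bit) \<Rightarrow> bit"
  where "\<And>y. additive (\<lambda>x. L x y)"
    and "\<And>x y. \<lbrakk>x \<in> F2_vecs n; y \<in> F2_vecs n\<rbrakk> \<Longrightarrow> \<alpha> (x + y) = \<alpha> x + \<alpha> y + L x y + L y x"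
proof -
  obtain c :: "nat \<Rightarrow> nat \<Rightarrow> nat \<Rightarrow> bit" where c: "\<And>x. x \<in> F2_vecs n \<Longrightarrow>
     \<alpha> x = (\<Sum>i = 1..n. \<Sum>j = i..n. \<Sum>k = j..n. c i j k * x i * x j * x k)"
    using assms unfolding cubic_form_def by blast
  \<comment> \<open>Of the eight products in the expansion of each term at \<open>x + y\<close>,
    \<open>L x y\<close> collects the three with one factor from \<open>x\<close> and two from
    \<open>y\<close>; \<open>L y x\<close> collects the three opposite ones.\<close>
  define L where "L x y = (\<Sum>i = 1..n. \<Sum>j = i..n. \<Sum>k = j..n.
      c i j k * (x i * y j * y k + y i * x j * y k + y i * y j * x k))" for x y :: "nat \<Rightarrow> bit"
  show thesis
  proof
    show "additive (\<lambda>x. L x y)" for y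
      unfolding additive_def L_def plus_fun_apply sum.distrib[symmetric]
      by (intro allI sum.cong refl) (simp only: algebra_simps)
  next
    fix x y assume x: "x \<in> F2_vecs n" and y: "y \<in> F2_vecs n"
    then have "x + y \<in> F2_vecs n" by (simp add: F2_vecs_def)
    then show "\<alpha> (x + y) = \<alpha> x + \<alpha> y + L x y + L y x"
      unfolding c[OF x] c[OF y] c[OF \<open>x + y \<in> F2_vecs n\<close>] L_def plus_fun_apply
        sum.distrib[symmetric]
      by (intro sum.cong refl) (simp only: algebra_simps)
  qed
qed

lemma zero_in_F2_vecs: "0 \<in> F2_vecs n"
  by (simp add: F2_vecs_def)

lemma cubic_form_0:
  assumes "cubic_form n \<alpha>"
  shows "\<alpha> 0 = 0"
  using assms zero_in_F2_vecs[of n] by (force simp: cubic_form_def)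

lemma finite_F2_vecs: "finite (F2_vecs n)"
proof -
  have "F2_vecs n \<subseteq> (\<lambda>T i. of_bool (i \<in> T)) ` Pow {1..n}"
  proof
    fix x assume "x \<in> F2_vecs n"
    then have "x = (\<lambda>i. of_bool (i \<in> {i. x i = 1}))" "{i. x i = 1} \<in> Pow {1..n}"
      by (auto simp: F2_vecs_def fun_eq_iff)
    then show "x \<in> (\<lambda>T i. of_bool (i \<in> T)) ` Pow {1..n}" by blast
  qed
  then show ?thesis by (rule finite_subset) simp
qed

section \<open>Rank bound for cliques and their sumsets\<close>

text \<open>The indicators of the points of \<open>X\<close> are independent, and they lie in the
  span of \<open>2 * card I + 2\<close> functions when \<open>I\<close> is a basis of the span of
  \<open>X\<close>.\<close>

lemma clique_rank:
  fixes X :: "(nat \<Rightarrow> bit) set"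
  assumes \<alpha>: "cubic_form n \<alpha>" and X: "X \<subseteq> F2_vecs n"
    and clique: "\<And>x y. \<lbrakk>x \<in> X; y \<in> X; x \<noteq> y\<rbrakk> \<Longrightarrow> \<alpha> (x + y) = 1"
  obtains I where "I \<subseteq> X" "bit_fun.independent I" "card X \<le> 2 * card I + 2"
proof -
  obtain I where I: "I \<subseteq> X" "bit_fun.independent I" "X \<subseteq> bit_fun.span I"
    using bit_fun.maximal_independent_subset by blast
  have fX: "finite X" using X finite_F2_vecs finite_subset by blast
  have fI: "finite I" using I(1) fX finite_subset by blast
  obtain L where L: "\<And>y. additive (\<lambda>x. L x y)"
    and \<alpha>_add: "\<And>x y. \<lbrakk>x \<in> F2_vecs n; y \<in> F2_vecs n\<rbrakk> \<Longrightarrow> \<alpha> (x + y) = \<alpha> x + \<alpha> y + L x y + L y x"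
    using cubic_form_add[OF \<alpha>] by blast
  have "\<forall>x\<in>X. \<exists>u. x = (\<Sum>v\<in>I. bit_scale (u v) v)"
    using I(3) unfolding bit_fun.span_finite[OF fI] by blast
  then obtain u where u: "\<And>x. x \<in> X \<Longrightarrow> x = (\<Sum>v\<in>I. bit_scale (u x v) v)"
    by metis
  have L_scale: "L (bit_scale c v) y = c * L v y" for c v y
    using additive.zero[OF L, of y] by (cases c) simp_all
  have L_u: "L x y = (\<Sum>v\<in>I. u x v * L v y)" if "x \<in> X" for x y
    using additive.sum[OF L, of "\<lambda>v. bit_scale (u x v) v" I y] u[OF that] by (simp add: L_scale)

  \<comment> \<open>Truncating to \<open>X\<close> turns identities that hold only on
    \<open>X\<close> into equalities of functions on the whole type.\<close>
  define r where "r f x = (if x \<in> X then f x else 0)" for f :: "(nat \<Rightarrow> bit) \<Rightarrow> bit" and x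
  define t where "t = {r (\<lambda>_. 1), r \<alpha>} \<union> (\<lambda>v. r (\<lambda>x. u x v)) ` I \<union> (\<lambda>v. r (L v)) ` I"
  define \<delta> where "\<delta> y = (\<lambda>x. of_bool (x = y) :: bit)" for y :: "nat \<Rightarrow> bit"
  have "finite t" by (simp add: t_def fI)
  have "card t \<le> 2 * card I + 2"
  proof -
    have "card t \<le> card {r (\<lambda>_. 1), r \<alpha>} + card ((\<lambda>v. r (\<lambda>x. u x v)) ` I) + card ((\<lambda>v. r (L v)) ` I)"
      unfolding t_def by (meson card_Un_le add_le_mono1 order_trans)
    also have "\<dots> \<le> 2 + card I + card I"
      by (intro add_mono card_image_le fI) (simp add: card_insert_if)
    finally show ?thesis by simp
  qed
  have \<delta>_span: "\<delta> y \<in> bit_fun.span t" if y: "y \<in> X" for y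
  proof -
    have "\<delta> y = bit_scale (1 + \<alpha> y) (r (\<lambda>_. 1)) + r \<alpha>
        + (\<Sum>v\<in>I. bit_scale (L v y) (r (\<lambda>x. u x v))) + (\<Sum>v\<in>I. bit_scale (u y v) (r (L v)))"
      (is "_ = ?R")
    proof
      fix x
      show "\<delta> y x = ?R x"
      proof (cases "x \<in> X")
        case True
        \<comment> \<open>For fixed \<open>y\<close>, \<open>L x y\<close> is a combination of the
          coordinates \<open>u x v\<close> with coefficients \<open>L v y\<close>, and
          \<open>L y x\<close> one of the functions \<open>L v\<close> with coefficients
          \<open>u y v\<close>; linearity in the first argument suffices for both.\<close>
        have "?R x = 1 + (\<alpha> x + \<alpha> y + L x y + L y x)"
          by (simp only: plus_fun_apply sum_fun_apply bit_scale_apply r_def True if_True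
              L_u[OF True] L_u[OF y] mult_1_left mult_1_right ac_simps)
        also have "\<dots> = 1 + \<alpha> (x + y)"
          using \<alpha>_add True y X by (simp add: subset_iff)
        \<comment> \<open>\<open>\<alpha> 0 = 0\<close> gives the diagonal value 1, the clique
          condition the zeros off it.\<close>
        also have "\<dots> = \<delta> y x"
          using clique[OF True y] cubic_form_0[OF \<alpha>] by (auto simp: \<delta>_def bit_fun_add_self)
        finally show ?thesis by simp
      next
        case False
        then show ?thesis using y by (auto simp: sum_fun_apply r_def \<delta>_def)
      qed
    qed
    also have "\<dots> \<in> bit_fun.span t"
      by (intro bit_fun.span_add bit_fun.span_sum bit_fun.span_scale bit_fun.span_base)
        (auto simp: t_def)
    finally show ?thesis .
  qed
  have inj_\<delta>: "inj_on \<delta> X"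
    by (auto simp: inj_on_def \<delta>_def fun_eq_iff split: if_splits)
  have "f (\<delta> y) = 0" if sum0: "(\<Sum>h\<in>\<delta> ` X. bit_scale (f h) h) = 0" and y: "y \<in> X" for f y
  proof -
    have "0 = (\<Sum>h\<in>\<delta> ` X. bit_scale (f h) h) y" by (simp add: sum0)
    also have "\<dots> = (\<Sum>z\<in>X. f (\<delta> z) * \<delta> z y)"
      by (simp add: sum.reindex[OF inj_\<delta>] sum_fun_apply)
    also have "\<dots> = (\<Sum>z\<in>X. if z = y then f (\<delta> y) else 0)"
      by (rule sum.cong) (auto simp: \<delta>_def)
    also have "\<dots> = f (\<delta> y)" using y fX by simp
    finally show ?thesis by simp
  qed
  then have "bit_fun.independent (\<delta> ` X)"
    using fX by (subst bit_fun.dependent_finite) auto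
  moreover have "\<delta> ` X \<subseteq> bit_fun.span t" using \<delta>_span by blast
  ultimately have "card (\<delta> ` X) \<le> card t"
    using bit_fun.independent_span_bound[OF \<open>finite t\<close>] by simp
  then have "card X \<le> 2 * card I + 2"
    using \<open>card t \<le> 2 * card I + 2\<close> by (simp add: card_image[OF inj_\<delta>])
  with I(1,2) show thesis by (rule that)
qed

lemma card_clique_sumset:
  fixes X :: "(nat \<Rightarrow> bit) set"
  assumes \<alpha>: "cubic_form n \<alpha>" and X: "X \<subseteq> F2_vecs n"
    and clique: "\<And>x y. \<lbrakk>x \<in> X; y \<in> X; x \<noteq> y\<rbrakk> \<Longrightarrow> \<alpha> (x + y) = 1"
  shows "(card X)\<^sup>2 \<le> 64 * card (X + X)"
proof (cases "X = {}")
  case False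
  have fX: "finite X" using X finite_F2_vecs finite_subset by blast
  obtain I where I: "I \<subseteq> X" "bit_fun.independent I" "card X \<le> 2 * card I + 2"
    using clique_rank[OF assms] by blast
  have fI: "finite I" using I(1) fX finite_subset by blast
  let ?P = "{T. T \<subseteq> I \<and> card T = 2}"
  have inj: "inj_on (\<lambda>T. \<Sum>T) (Pow I)"
    by (rule inj_on_subset_sums[OF fI I(2)])
  \<comment> \<open>The empty subset contributes \<open>0 = x + x\<close>, which keeps the count
    positive when \<open>card I < 2\<close>.\<close>
  have "(\<lambda>T. \<Sum>T) ` insert {} ?P \<subseteq> X + X"
  proof
    fix z assume "z \<in> (\<lambda>T. \<Sum>T) ` insert {} ?P"
    then consider "z = 0" | x y where "x \<in> I" "y \<in> I" "x \<noteq> y" "z = x + y"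
      by (auto simp: card_2_iff)
    then show "z \<in> X + X"
    proof cases
      case 1
      with False show ?thesis by (metis bit_fun_add_self set_plus_intro ex_in_conv)
    qed (use I(1) in auto)
  qed
  then have "card ((\<lambda>T. \<Sum>T) ` insert {} ?P) \<le> card (X + X)"
    by (rule card_mono[rotated]) (simp add: fX finite_set_plus)
  moreover have "card ((\<lambda>T. \<Sum>T) ` insert {} ?P) = Suc (card I choose 2)"
    by (subst card_image[OF inj_on_subset[OF inj]]) (auto simp: n_subsets fI)
  ultimately have "Suc (card I choose 2) \<le> card (X + X)" by simp
  \<comment> \<open>The constant 64 is generous; as \<open>4 ^ 3\<close> it has a convenient cube
    root later.\<close>
  moreover have "(card X)\<^sup>2 \<le> 64 * Suc (card I choose 2)"
  proof -
    define m where "m = real (card I)"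
    have "even (card I * (card I - 1))" by (cases "card I") auto
    then have "real (card I choose 2) = m * (m - 1) / 2"
      by (cases "card I") (auto simp: choose_two m_def real_of_nat_div algebra_simps)
    moreover have "(real (card X))\<^sup>2 \<le> (2 * m + 2)\<^sup>2"
      using I(3) by (intro power_mono) (auto simp: m_def)
    moreover have "(2 * m + 2)\<^sup>2 \<le> 64 * (1 + m * (m - 1) / 2)"
      using zero_le_power2[of "m - 1"] by (simp add: m_def power2_eq_square field_simps)
    ultimately have "(real (card X))\<^sup>2 \<le> 64 * (1 + real (card I choose 2))" by simp
    then have "real ((card X)\<^sup>2) \<le> real (64 * Suc (card I choose 2))" by simp
    then show ?thesis by (simp only: of_nat_le_iff)
  qed
  ultimately show ?thesis by (meson mult_le_mono2 order_trans)
qed simp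

section \<open>Averaging over fibres and the final bound\<close>

text \<open>The fibres over \<open>s \<in> A + B\<close> cover \<open>A \<times> B\<close>, so some
  fibre has at least average size; the average is stated without division.\<close>

lemma card_le_sumset_times_fibre:
  fixes A B :: "('a \<Rightarrow> bit) set"
  assumes "finite A" "finite B" "A \<noteq> {}" "B \<noteq> {}"
  obtains s where "card A * card B \<le> card (A + B) * card {x \<in> A. s + x \<in> B}"
proof (rule ccontr)
  assume "\<not> thesis"
  with that have less: "card (A + B) * card {x \<in> A. s + x \<in> B} < card A * card B" for s
    using not_le by blast
  have "A \<times> B \<subseteq> (\<lambda>(s, x). (x, s + x)) ` (SIGMA s : A + B. {x \<in> A. s + x \<in> B})"
  proof clarify
    fix x y assume "x \<in> A" "y \<in> B"
    \<comment> \<open>In characteristic 2, \<open>y = s - x\<close> reads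
      \<open>y = s + x\<close>.\<close>
    moreover have "x + y + x = y"
      by (metis add.assoc add.commute add_0 bit_fun_add_self)
    ultimately show "(x, y) \<in> (\<lambda>(s, x). (x, s + x)) ` (SIGMA s : A + B. {x \<in> A. s + x \<in> B})"
      by (intro image_eqI[of _ _ "(x + y, x)"]) auto
  qed
  then have "card (A \<times> B) \<le> card (SIGMA s : A + B. {x \<in> A. s + x \<in> B})"
    using assms by (intro surj_card_le) (auto simp: finite_set_plus)
  also have "\<dots> = (\<Sum>s\<in>A + B. card {x \<in> A. s + x \<in> B})"
    using assms by (intro card_SigmaI) (auto simp: finite_set_plus)
  finally have "card (A + B) * (card A * card B)
      \<le> (\<Sum>s\<in>A + B. card (A + B) * card {x \<in> A. s + x \<in> B})"
    by (simp add: card_cartesian_product sum_distrib_left[symmetric])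
  also have "\<dots> < (\<Sum>s\<in>A + B. card A * card B)"
  proof (rule sum_strict_mono)
    show "finite (A + B)" using assms by (simp add: finite_set_plus)
    show "A + B \<noteq> {}" using assms by (auto simp: set_plus_def)
  qed (rule less)
  finally show False by simp
qed

lemma card_sumset_cube:
  assumes \<alpha>: "cubic_form n \<alpha>" and A: "A \<subseteq> F2_vecs n" and B: "B \<subseteq> F2_vecs n"
    and quad: "\<And>x x' y y'. proper_additive_quadruple A B x x' y y' \<Longrightarrow> \<alpha> (x + x') = 1"
  shows "(card A * card B)\<^sup>2 \<le> 64 * card (A + B) ^ 3"
proof (cases "A = {} \<or> B = {}")
  case False
  have fin: "finite A" "finite B" using A B finite_F2_vecs finite_subset by blast+
  obtain s where s: "card A * card B \<le> card (A + B) * card {x \<in> A. s + x \<in> B}"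
    using card_le_sumset_times_fibre fin False by blast
  define X where "X = {x \<in> A. s + x \<in> B}"
  have "\<alpha> (x + y) = 1" if "x \<in> X" "y \<in> X" "x \<noteq> y" for x y
  proof (rule quad)
    have "x + y + (s + x) + (s + y) = (x + x) + (y + y) + (s + s)"
      by (simp add: algebra_simps)
    then show "proper_additive_quadruple A B x y (s + x) (s + y)"
      using that by (simp add: proper_additive_quadruple_def X_def bit_fun_add_self)
  qed
  then have "(card X)\<^sup>2 \<le> 64 * card (X + X)"
    using A by (intro card_clique_sumset[OF \<alpha>]) (auto simp: X_def)
  also have "card (X + X) = card ((+) s ` (X + X))"
    by (simp add: card_image)
  also have "\<dots> \<le> card (A + B)"
  proof (rule card_mono)
    show "(+) s ` (X + X) \<subseteq> A + B"
    proof clarify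
      fix z assume "z \<in> X + X"
      then obtain x y where "x \<in> X" "y \<in> X" "z = x + y" by (auto elim: set_plus_elim)
      \<comment> \<open>Moving \<open>s\<close> onto \<open>y\<close> leaves
        \<open>x \<in> A\<close> and lands \<open>s + y\<close> in \<open>B\<close>.\<close>
      moreover have "s + (x + y) = x + (s + y)" by (simp add: algebra_simps)
      ultimately show "s + z \<in> A + B" by (metis (lifting) X_def mem_Collect_eq set_plus_intro)
    qed
  qed (simp add: fin finite_set_plus)
  finally have X2: "(card X)\<^sup>2 \<le> 64 * card (A + B)" by simp
  have "(card A * card B)\<^sup>2 \<le> (card (A + B) * card X)\<^sup>2"
    using s by (intro power_mono) (auto simp: X_def)
  also have "\<dots> \<le> (card (A + B))\<^sup>2 * (64 * card (A + B))"
    unfolding power_mult_distrib using X2 by (intro mult_left_mono) auto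
  finally show ?thesis by (simp add: power2_eq_square power3_eq_cube algebra_simps)
qed auto

theorem theorem5p1:
  shows "\<exists>C::real. C > 0 \<and>
    (\<forall>(n::nat) (\<alpha> :: (nat \<Rightarrow> bit) \<Rightarrow> bit) (A :: (nat \<Rightarrow> bit) set) (B :: (nat \<Rightarrow> bit) set).
       cubic_form n \<alpha> \<longrightarrow> A \<subseteq> F2_vecs n \<longrightarrow> B \<subseteq> F2_vecs n \<longrightarrow> card A \<le> card B \<longrightarrow>
       (\<forall>x x' y y'. proper_additive_quadruple A B x x' y y' \<longrightarrow> \<alpha> (x + x') = 1) \<longrightarrow>
       real (card (A + B)) \<ge> C * real (card A) powr (6 / 5))"
proof (intro exI[of _ "1 / 4"] conjI allI impI)
  fix n \<alpha> A B
  assume \<alpha>: "cubic_form n \<alpha>" and A: "A \<subseteq> F2_vecs n" and B: "B \<subseteq> F2_vecs n"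
    and le: "card A \<le> card B"
    and quad: "\<forall>x x' y y'. proper_additive_quadruple A B x x' y y' \<longrightarrow> \<alpha> (x + x') = 1"
  define a S where "a = real (card A)" and "S = real (card (A + B))"
  show "real (card (A + B)) \<ge> 1 / 4 * real (card A) powr (6 / 5)"
  proof (cases "card A = 0")
    case False
    then have a: "a \<ge> 1" by (simp add: a_def)
    have "(card A * card A)\<^sup>2 \<le> (card A * card B)\<^sup>2"
      using le by (intro power_mono mult_left_mono) auto
    also have "\<dots> \<le> 64 * card (A + B) ^ 3"
      using card_sumset_cube[OF \<alpha> A B] quad by blast
    finally have "real ((card A * card A)\<^sup>2) \<le> real (64 * card (A + B) ^ 3)"
      by (simp only: of_nat_le_iff)
    \<comment> \<open>The right side is now a cube, so a cube root yields the constant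
      \<open>1 / 4\<close>.\<close>
    then have a4: "a ^ 4 \<le> (4 * S) ^ 3"
      by (simp add: a_def S_def power_mult_distrib power2_eq_square power4_eq_xxxx)
    have "(a powr (6 / 5)) ^ 3 = a powr (18 / 5)"
      using a by (simp add: powr_powr flip: powr_realpow)
    \<comment> \<open>The exponent 4/3 is weakened to 6/5 here, using
      \<open>a \<ge> 1\<close>.\<close>
    also have "\<dots> \<le> a powr 4" using a by (intro powr_mono) auto
    also have "\<dots> = a ^ 4" using a by (simp add: powr_numeral)
    also note a4
    finally have "a powr (6 / 5) \<le> 4 * S"
      by (rule power_le_imp_le_base[of _ 2, unfolded Suc_numeral, simplified]) (simp add: S_def)
    then show ?thesis by (simp add: a_def S_def)
  qed simp
qed simp

end
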